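(* No efficient mechanism satisfies strong decomposability when $m\ge 3$ and $n\ge 2$. That is: for every finite set $A$ of $m\ge 3$ projects and every finite set $N$ of $n\ge 2$ agents, there exist budgets $B_i>0$ and normalized utility functions $u_i\colon A\to\mathbb R_{\ge0}$ ($i\in N$) such that no mechanism is both efficient and strongly decomposable.
   Context: For $V\ge 0$, $\Delta(V)$ is the set of functions $\delta\colon A\to\mathbb R_{\ge0}$ with $\sum_{x\in A}\delta(x)=V$. Each agent $i\in N$ has a budget $B_i>0$ and a utility function $u_i\colon A\to\mathbb R_{\ge0}$, not identically zero and normalized so that $\min\{u_i(x)\colon x\in A, u_i(x)>0\}=1$; $u_i(\delta)=\sum_{x\in A}\delta(x)u_i(x)$. A (contribution) profile is $C=(C_i)_{i\in N}$ with $C_i\in[0,B_i]$; $|C|=\sum_{i\in N}C_i$. Utilities and budgets being fixed, a mechanism $f$ maps every profile $C$ to a distribution $f(C)\in\Delta(|C|)$. Given a profile $C$, $\delta'\in\Delta(|C|)$ dominates $\delta\in\Delta(|C|)$ if $u_i(\delta')\ge u_i(\delta)$ for all $i\in N$ with $C_i>0$ and $u_i(\delta')>u_i(\delta)$ for some $i\in N$ with $C_i>0$. A mechanism $f$ is efficient if for every profile $C$ no distribution in $\Delta(|C|)$ dominates $f(C)$. A distribution $\delta\in\Delta(|C|)$ is strongly decomposable (with respect to $C$) if there are $\delta_i\in\Delta(C_i)$, $i\in N$, with $\delta=\sum_{i\in N}\delta_i$ such that for all $i\in N$, $\delta_i(x)>0$ only if $u_i(x)\ge u_i(y)$ for all $y\in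 A$. A mechanism $f$ is strongly decomposable if $f(C)$ is strongly decomposable with respect to $C$ for every profile $C$. *)

theory Defs
  imports Complex_Main "HOL-Library.FuncSet"
begin

text \<open>
  The finite sets \<open>A\<close> of projects and \<open>N\<close> of agents are explicit carriers. Distributions and
  profiles are functions on these carriers in the sense of the extensional function space
  \<open>\<rightarrow>\<^sub>E\<close>, so a mechanism can depend on nothing but the contributions of the agents in \<open>N\<close>.
\<close>

definition distributions :: "'a set \<Rightarrow> real \<Rightarrow> ('a \<Rightarrow> real) set" where
  "distributions A V = {\<delta> \<in> A \<rightarrow>\<^sub>E {0..}. (\<Sum>x\<in>A. \<delta> x) = V}"

definition normalized_utility :: "'a set \<Rightarrow> ('a \<Rightarrow> real) \<Rightarrow> bool" where
  "normalized_utility A v \<longleftrightarrow>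
     (\<forall>x\<in>A. v x \<ge> 0) \<and> (\<exists>x\<in>A. v x \<noteq> 0) \<and> Min {v x | x. x \<in> A \<and> v x > 0} = 1"

definition utility :: "'a set \<Rightarrow> ('a \<Rightarrow> real) \<Rightarrow> ('a \<Rightarrow> real) \<Rightarrow> real" where
  "utility A v \<delta> = (\<Sum>x\<in>A. \<delta> x * v x)"

definition profiles :: "'i set \<Rightarrow> ('i \<Rightarrow> real) \<Rightarrow> ('i \<Rightarrow> real) set" where
  "profiles N B = (\<Pi>\<^sub>E i\<in>N. {0..B i})"

definition mechanism ::
  "'a set \<Rightarrow> 'i set \<Rightarrow> ('i \<Rightarrow> real) \<Rightarrow> (('i \<Rightarrow> real) \<Rightarrow> ('a \<Rightarrow> real)) \<Rightarrow> bool" where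
  "mechanism A N B f \<longleftrightarrow> (\<forall>C\<in>profiles N B. f C \<in> distributions A (\<Sum>i\<in>N. C i))"

definition dominates ::
  "'a set \<Rightarrow> 'i set \<Rightarrow> ('i \<Rightarrow> 'a \<Rightarrow> real) \<Rightarrow> ('i \<Rightarrow> real) \<Rightarrow> ('a \<Rightarrow> real) \<Rightarrow> ('a \<Rightarrow> real) \<Rightarrow> bool" where
  "dominates A N u C \<delta>' \<delta> \<longleftrightarrow>
     (\<forall>i\<in>N. C i > 0 \<longrightarrow> utility A (u i) \<delta>' \<ge> utility A (u i) \<delta>) \<and>
     (\<exists>i\<in>N. C i > 0 \<and> utility A (u i) \<delta>' > utility A (u i) \<delta>)"

definition efficient ::
  "'a set \<Rightarrow> 'i set \<Rightarrow> ('i \<Rightarrow> real) \<Rightarrow> ('i \<Rightarrow> 'a \<Rightarrow> real) \<Rightarrow> (('i \<Rightarrow> real) \<Rightarrow> ('a \<Rightarrow> real)) \<Rightarrow> bool" where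
  "efficient A N B u f \<longleftrightarrow>
     (\<forall>C\<in>profiles N B. \<not> (\<exists>\<delta>\<in>distributions A (\<Sum>i\<in>N. C i). dominates A N u C \<delta> (f C)))"

definition strongly_decomposable_wrt ::
  "'a set \<Rightarrow> 'i set \<Rightarrow> ('i \<Rightarrow> 'a \<Rightarrow> real) \<Rightarrow> ('i \<Rightarrow> real) \<Rightarrow> ('a \<Rightarrow> real) \<Rightarrow> bool" where
  "strongly_decomposable_wrt A N u C \<delta> \<longleftrightarrow>
     (\<exists>d. (\<forall>i\<in>N. d i \<in> distributions A (C i)) \<and>
          (\<forall>x\<in>A. \<delta> x = (\<Sum>i\<in>N. d i x)) \<and>
          (\<forall>i\<in>N. \<forall>x\<in>A. d i x > 0 \<longrightarrow> (\<forall>y\<in>A. u i x \<ge> u i y)))"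

definition strongly_decomposable ::
  "'a set \<Rightarrow> 'i set \<Rightarrow> ('i \<Rightarrow> real) \<Rightarrow> ('i \<Rightarrow> 'a \<Rightarrow> real) \<Rightarrow> (('i \<Rightarrow> real) \<Rightarrow> ('a \<Rightarrow> real)) \<Rightarrow> bool" where
  "strongly_decomposable A N B u f \<longleftrightarrow>
     (\<forall>C\<in>profiles N B. strongly_decomposable_wrt A N u C (f C))"

end

theory Submission
  imports Defs
begin

text \<open>
  Two agents contribute 1 each, with different favourite projects worth 3/2 to their own fan and
  nothing to the other; a third, compromise project is worth 1 to both. Strong decomposability
  forces each contribution onto the contributor's favourite, giving both agents utility 3/2,
  whereas spending everything on the compromise gives both utility 2.
\<close>

text \<open>Weights are nonnegative, so a project outside the support contributes 0 to the utility;
  a bound on \<open>v\<close> over the support is enough.\<close>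

lemma utility_le_of_support:
  assumes d: "d \<in> distributions A V"
    and le: "\<And>x. x \<in> A \<Longrightarrow> d x > 0 \<Longrightarrow> v x \<le> k"
  shows "utility A v d \<le> k * V"
proof -
  have "d x * v x \<le> k * d x" if "x \<in> A" for x
  proof (cases "d x > 0")
    case True
    then show ?thesis using le[OF that] by (simp add: mult.commute)
  next
    case False
    moreover have "d x \<ge> 0" using d that by (auto simp: distributions_def)
    ultimately show ?thesis by simp
  qed
  then have "utility A v d \<le> (\<Sum>x\<in>A. k * d x)"
    unfolding utility_def by (rule sum_mono)
  also have "\<dots> = k * V"
    using d by (simp add: distributions_def flip: sum_distrib_left)
  finally show ?thesis .
qed

text \<open>When \<open>t i\<close> is the unique favourite of agent \<open>i\<close>, the part
  \<open>d i\<close> can only put weight on \<open>t i\<close>. The valuation \<open>v\<close> is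
  arbitrary, so the outcome can be judged from any agent's viewpoint.\<close>

lemma utility_le_if_strongly_decomposable:
  assumes dec: "strongly_decomposable_wrt A N u C \<delta>"
    and t: "\<And>i. i \<in> N \<Longrightarrow> t i \<in> A"
    and best: "\<And>i x. i \<in> N \<Longrightarrow> x \<in> A \<Longrightarrow> x \<noteq> t i \<Longrightarrow> u i x < u i (t i)"
  shows "utility A v \<delta> \<le> (\<Sum>i\<in>N. v (t i) * C i)"
proof -
  obtain d where d: "\<And>i. i \<in> N \<Longrightarrow> d i \<in> distributions A (C i)"
    and \<delta>: "\<And>x. x \<in> A \<Longrightarrow> \<delta> x = (\<Sum>i\<in>N. d i x)"
    and supp: "\<And>i x y. \<lbrakk>i \<in> N; x \<in> A; d i x > 0; y \<in> A\<rbrakk> \<Longrightarrow> u i x \<ge> u i y"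
    using dec unfolding strongly_decomposable_wrt_def by metis
  have "utility A v \<delta> = (\<Sum>x\<in>A. \<Sum>i\<in>N. d i x * v x)"
    unfolding utility_def by (simp add: \<delta> sum_distrib_right)
  also have "\<dots> = (\<Sum>i\<in>N. utility A v (d i))"
    unfolding utility_def by (rule sum.swap)
  also have "\<dots> \<le> (\<Sum>i\<in>N. v (t i) * C i)"
  proof (rule sum_mono, rule utility_le_of_support)
    fix i x assume "i \<in> N" "x \<in> A" "d i x > 0"
    then have "x = t i" using supp best t by (meson not_le)
    then show "v x \<le> v (t i)" by simp
  qed (use d in auto)
  finally show ?thesis .
qed

theorem proposition1:
  fixes A :: "'a set" and N :: "'i set"
  assumes "finite A" and "card A \<ge> 3" and "finite N" and "card N \<ge> 2"
  shows "\<exists>(B :: 'i \<Rightarrow> real) (u :: 'i \<Rightarrow> 'a \<Rightarrow> real).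
           (\<forall>i\<in>N. B i > 0) \<and> (\<forall>i\<in>N. normalized_utility A (u i)) \<and>
           \<not> (\<exists>f. mechanism A N B f \<and> efficient A N B u f \<and> strongly_decomposable A N B u f)"
proof -
  obtain a b c where abc: "a \<in> A" "b \<in> A" "c \<in> A" "a \<noteq> b" "a \<noteq> c" "b \<noteq> c"
    using \<open>card A \<ge> 3\<close> by (auto simp: card_le_Suc_iff numeral_eq_Suc)
  obtain p q where pq: "p \<in> N" "q \<in> N" "p \<noteq> q"
    using \<open>card N \<ge> 2\<close> by (auto simp: card_le_Suc_iff numeral_eq_Suc)
  \<comment> \<open>Favourites: \<open>p\<close> has \<open>a\<close>, every other agent shares
    \<open>b\<close> with \<open>q\<close>.\<close>
  define t where "t i = (if i = p then a else b)" for i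
  \<comment> \<open>Any value strictly between 1 and 2 could replace 3/2: above 1 it makes
    \<open>t i\<close> the strict favourite, below 2 it makes the compromise \<open>c\<close> pay
    off.\<close>
  define u :: "'i \<Rightarrow> 'a \<Rightarrow> real" where
    "u i x = (if x = t i then 3/2 else if x = c then 1 else 0)" for i x
  \<comment> \<open>With all budgets equal to 1, \<open>p\<close> and \<open>q\<close> give
    everything and the others nothing, so domination ignores the others.\<close>
  define C :: "'i \<Rightarrow> real" where "C = restrict (\<lambda>i. if i \<in> {p, q} then 1 else 0) N"
  define \<delta> :: "'a \<Rightarrow> real" where "\<delta> = restrict (\<lambda>x. if x = c then 2 else 0) A"
  have t: "t i \<in> A" "t i \<noteq> c" for i using abc by (auto simp: t_def)
  have "normalized_utility A (u i)" for i
  proof -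
    have "{u i x |x. x \<in> A \<and> u i x > 0} = {1, 3/2}"
      using t[of i] \<open>c \<in> A\<close> by (force simp: u_def)
    moreover have "\<exists>x\<in>A. u i x \<noteq> 0" using t[of i] by (auto simp: u_def)
    ultimately show ?thesis by (simp add: normalized_utility_def) (simp add: u_def)
  qed
  moreover have False
    if f: "efficient A N (\<lambda>_. 1) u f" "strongly_decomposable A N (\<lambda>_. 1) u f" for f
  proof -
    have C: "C \<in> profiles N (\<lambda>_. 1)" by (auto simp: C_def profiles_def)
    \<comment> \<open>Used with \<open>g\<close> constantly 1 for the total contribution 2, and with
      \<open>g i = u j (t i)\<close> for the utility bound.\<close>
    have sumC: "(\<Sum>i\<in>N. g i * C i) = g p + g q" for g :: "'i \<Rightarrow> real"
    proof -
      have "(\<Sum>i\<in>N. g i * C i) = (\<Sum>i\<in>{p, q}. g i * C i)"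
        using pq \<open>finite N\<close> by (intro sum.mono_neutral_right) (auto simp: C_def)
      then show ?thesis using pq by (simp add: C_def)
    qed
    have "\<delta> \<in> distributions A 2"
      using \<open>c \<in> A\<close> \<open>finite A\<close> by (simp add: distributions_def \<delta>_def)
    then have \<delta>: "\<delta> \<in> distributions A (\<Sum>i\<in>N. C i)"
      using sumC[of "\<lambda>_. 1"] by simp
    have "utility A (u i) \<delta> = 2" for i
    proof -
      have "utility A (u i) \<delta> = (\<Sum>x\<in>A. if x = c then 2 * u i c else 0)"
        unfolding utility_def \<delta>_def by (rule sum.cong) auto
      then show ?thesis using \<open>c \<in> A\<close> \<open>finite A\<close> t(2)[of i] by (simp add: u_def)
    qed
    moreover have "utility A (u j) (f C) \<le> 3/2" if "j \<in> {p, q}" for j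
    proof -
      have "utility A (u j) (f C) \<le> (\<Sum>i\<in>N. u j (t i) * C i)"
        using f(2) C t(1)
        by (intro utility_le_if_strongly_decomposable[where u = u])
          (auto simp: strongly_decomposable_def u_def)
      \<comment> \<open>Exactly one of the two contributions goes to the favourite of
        \<open>j\<close>; the other lands on a project worth 0 to \<open>j\<close>.\<close>
      also have "\<dots> = 3/2" using that pq abc by (auto simp: sumC u_def t_def)
      finally show ?thesis .
    qed
    \<comment> \<open>Both contributors gain strictly, as 2 > 3/2.\<close>
    ultimately have "dominates A N u C \<delta> (f C)"
      using pq by (fastforce simp: dominates_def C_def split: if_splits)
    then show False using f(1) C \<delta> by (auto simp: efficient_def)
  qed
  ultimately show ?thesis
    by (intro exI[of _ "\<lambda>_. 1"] exI[of _ u]) auto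
qed

end
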